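(* For any $d=1,\dots,n^2-n+1$, there exists a $d$-dimensional linear subspace $W\subseteq\mathbb{C}^{n\times n}$ such that a decomposition of an arbitrary matrix in $\mathbb{C}^{n\times n}$ into a product of $r$ elements of $W$ does not exist for any $r\in\mathbb{N}$. For example, $W$ can be taken to be any $d$-dimensional subspace of $\mathbb{C}^{n\times n}$ consisting of matrices whose entries below the $(1,1)$-entry in the first column are all zero; since this structure is preserved under matrix product, the semigroup generated by $W$, i.e., the set of all products of matrices from $W$, is never equal to all of $\mathbb{C}^{n\times n}$.
   Context: $\mathbb{C}^{n\times n}$ denotes the space of $n\times n$ complex matrices, and dimension means dimension as a complex vector space.
   Formalization: The formal theorem assumes n ≥ 2; for n = 1 the claim fails, since d = 1 forces W to be all 1×1 matrices and every matrix is then a product of one element of W. *)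

theory Defs
  imports "HOL-Analysis.Analysis"
begin

(* The library's "*s" on complex^'n^'n would take its scalars from complex^'n, and its
   "subspace" and "dim" are over the reals, so the complex vector space structure on
   matrices is set up here. *)
definition cmat_scale :: "complex \<Rightarrow> complex^'n^'m \<Rightarrow> complex^'n^'m"
  where "cmat_scale c A = (\<chi> i j. c * A $ i $ j)"

interpretation cmat: vector_space "cmat_scale :: complex \<Rightarrow> complex^'n^'m \<Rightarrow> complex^'n^'m"
  by unfold_locales (simp_all add: cmat_scale_def vec_eq_iff algebra_simps)

definition matrix_prod :: "(complex^'n^'n) list \<Rightarrow> complex^'n^'n"
  where "matrix_prod As = foldr (**) As (mat 1)"

definition decomposes_into :: "nat \<Rightarrow> (complex^'n^'n) set \<Rightarrow> complex^'n^'n \<Rightarrow> bool"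
  where "decomposes_into r W A \<longleftrightarrow> (\<exists>As. length As = r \<and> set As \<subseteq> W \<and> A = matrix_prod As)"

definition mult_closed :: "(complex^'n^'n) set \<Rightarrow> bool"
  where "mult_closed S \<longleftrightarrow> (\<forall>A\<in>S. \<forall>B\<in>S. A ** B \<in> S)"

definition generated_semigroup :: "(complex^'n^'n) set \<Rightarrow> (complex^'n^'n) set"
  where "generated_semigroup W = mult_closed hull W"

(* The linear order on the index type says which index is first and which rows lie below. *)
definition first_index :: "'n::{finite,linorder}"
  where "first_index = Min UNIV"

definition zero_below_first :: "(complex^'n::{finite,linorder}^'n::{finite,linorder}) set"
  where "zero_below_first = {A. \<forall>i > first_index. A $ i $ first_index = 0}"

end

theory Submission
  imports Defs
begin

text \<open>Matrices whose first column vanishes below its top entry are those that map the first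
  coordinate line to itself. They therefore form a monoid under multiplication, so no product of
  such matrices, of whatever length, can leave this set
  (\<open>mult_closed_zero_below_first\<close>, \<open>matrix_prod_in_closed\<close>). For
  \<open>n \<ge> 2\<close> the set is proper, because it omits the matrix units with a nonzero entry
  below the top of the first column. Hence no subspace of it generates all matrices.

  It remains to see that every dimension up to \<open>n\<^sup>2 - n + 1\<close> occurs among its
  subspaces. The matrix units at the \<open>n\<^sup>2 - (n - 1)\<close> unconstrained positions are
  linearly independent (\<open>independent_matrix_units\<close>) and lie in the set, so any
  \<open>d\<close> of them span a subspace as required.\<close>

definition matrix_unit :: "'m \<Rightarrow> 'n \<Rightarrow> complex^'n^'m"
  where "matrix_unit i j = (\<chi> a b. if a = i \<and> b = j then 1 else 0)"

lemma inj_matrix_unit: "inj (\<lambda>(i, j). matrix_unit i j :: complex^'n^'m)"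
proof (rule injI, clarify)
  fix i k :: 'm and j l :: 'n
  assume "matrix_unit i j = (matrix_unit k l :: complex^'n^'m)"
  then have "(matrix_unit k l :: complex^'n^'m) $ i $ j = matrix_unit i j $ i $ j"
    by simp
  then show "i = k \<and> j = l"
    by (simp add: matrix_unit_def split: if_splits)
qed

text \<open>The entry of a linear combination at a given position is the coefficient of the one unit
  supported there, so a vanishing combination has vanishing coefficients.\<close>
lemma independent_matrix_units:
  "cmat.independent ((\<lambda>(i, j). matrix_unit i j :: complex^'n^'m) ` P)"
proof (rule cmat.independent_if_scalars_zero)
  let ?E = "\<lambda>(i, j). matrix_unit i j :: complex^'n^'m"
  show "finite (?E ` P)" by simp
  fix f and x :: "complex^'n^'m"
  assume zero: "(\<Sum>y\<in>?E ` P. cmat_scale (f y) y) = 0" and "x \<in> ?E ` P"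
  then obtain i j where x: "x = matrix_unit i j" by auto
  have other: "y $ i $ j = 0" if "y \<in> ?E ` P" "y \<noteq> x" for y
    using that x by (auto simp: matrix_unit_def)
  have "0 = (\<Sum>y\<in>?E ` P. cmat_scale (f y) y) $ i $ j"
    using zero by simp
  also have "\<dots> = (\<Sum>y\<in>?E ` P. f y * y $ i $ j)"
    by (simp add: cmat_scale_def)
  also have "\<dots> = (\<Sum>y\<in>?E ` P. if y = x then f x else 0)"
  proof (rule sum.cong[OF refl])
    fix y assume "y \<in> ?E ` P"
    then show "f y * y $ i $ j = (if y = x then f x else 0)"
      using other[of y] by (cases "y = x") (simp_all add: x matrix_unit_def)
  qed
  also have "\<dots> = f x"
    using \<open>x \<in> ?E ` P\<close> by simp
  finally show "f x = 0" by simp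
qed

lemma first_index_least: "first_index \<le> (i :: 'n::{finite,linorder})"
  by (simp add: first_index_def)

lemma subspace_zero_below_first:
  "cmat.subspace (zero_below_first :: (complex^'n::{finite,linorder}^'n::{finite,linorder}) set)"
  by (rule cmat.subspaceI) (auto simp: zero_below_first_def cmat_scale_def)

lemma matrix_unit_in_zero_below_first:
  "matrix_unit i j \<in> zero_below_first \<longleftrightarrow> i = first_index \<or> j \<noteq> first_index"
  using first_index_least[of i] by (auto simp: zero_below_first_def matrix_unit_def)

lemma mat_1_in_zero_below_first: "mat 1 \<in> zero_below_first"
  by (auto simp: zero_below_first_def mat_def)

text \<open>In \<open>\<Sum>k. A\<^sub>i\<^sub>k B\<^sub>k\<^sub>1\<close> with \<open>i > 1\<close>, the
  factor from \<open>A\<close> vanishes for \<open>k = 1\<close> and the factor from \<open>B\<close>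
  for \<open>k > 1\<close>.\<close>
lemma mult_closed_zero_below_first:
  "mult_closed (zero_below_first :: (complex^'n::{finite,linorder}^'n::{finite,linorder}) set)"
proof (unfold mult_closed_def, intro ballI)
  fix A B :: "complex^'n::{finite,linorder}^'n::{finite,linorder}"
  assume A: "A \<in> zero_below_first" and B: "B \<in> zero_below_first"
  have "A $ i $ k * B $ k $ first_index = 0" if "i > first_index" for i k
  proof (cases "k = first_index")
    case True
    then show ?thesis using A that by (simp add: zero_below_first_def)
  next
    case False
    then have "k > first_index" using first_index_least[of k] by simp
    then show ?thesis using B by (simp add: zero_below_first_def)
  qed
  then show "A ** B \<in> zero_below_first"
    unfolding zero_below_first_def matrix_matrix_mult_def
    by (auto intro!: sum.neutral simp only: vec_lambda_beta)
qed

lemma subspace_of_dim_in_zero_below_first: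
  assumes "d \<le> CARD('n::{finite,linorder})^2 - CARD('n) + 1"
  shows "\<exists>W :: (complex^'n::{finite,linorder}^'n::{finite,linorder}) set.
    cmat.subspace W \<and> cmat.dim W = d \<and> W \<subseteq> zero_below_first"
proof -
  let ?E = "\<lambda>(i, j). matrix_unit i j :: complex^'n::{finite,linorder}^'n::{finite,linorder}"
  define forbidden where "forbidden = (UNIV - {first_index :: 'n}) \<times> {first_index :: 'n}"
  have "card forbidden = CARD('n) - 1"
    by (simp add: forbidden_def card_cartesian_product)
  then have "card (- forbidden) = CARD('n)^2 - (CARD('n) - 1)"
    by (simp add: Compl_eq_Diff_UNIV card_Diff_subset power2_eq_square)
  moreover have "CARD('n) \<le> CARD('n)^2" "CARD('n) \<ge> 1"
    by (simp_all add: power2_eq_square Suc_leI)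
  ultimately have "d \<le> card (- forbidden)"
    using assms by simp
  then obtain P where P: "P \<subseteq> - forbidden" "card P = d"
    by (meson obtain_subset_with_card_n)
  let ?W = "cmat.span (?E ` P)"
  have "cmat.dim ?W = card (?E ` P)"
    by (rule cmat.dim_span_eq_card_independent[OF independent_matrix_units])
  also have "\<dots> = d"
    using P(2) by (simp add: card_image inj_on_subset[OF inj_matrix_unit])
  finally have "cmat.dim ?W = d" .
  moreover have "?W \<subseteq> zero_below_first"
  proof (rule cmat.span_minimal[OF _ subspace_zero_below_first])
    show "?E ` P \<subseteq> zero_below_first"
      using P(1) by (auto simp: matrix_unit_in_zero_below_first forbidden_def)
  qed
  ultimately show ?thesis
    using cmat.subspace_span by blast
qed

lemma zero_below_first_proper:
  assumes "CARD('n::{finite,linorder}) \<ge> 2"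
  shows "\<exists>A :: complex^'n::{finite,linorder}^'n::{finite,linorder}. A \<notin> zero_below_first"
proof -
  have "UNIV \<noteq> {first_index :: 'n}"
  proof
    assume "UNIV = {first_index :: 'n}"
    then have "CARD('n) = card {first_index :: 'n}" by (rule arg_cong)
    with assms show False by simp
  qed
  then obtain i :: 'n where "i \<noteq> first_index" by blast
  then have "(matrix_unit i first_index :: complex^'n::{finite,linorder}^'n::{finite,linorder}) \<notin> zero_below_first"
    by (simp add: matrix_unit_in_zero_below_first)
  then show ?thesis by blast
qed

lemma matrix_prod_Cons: "matrix_prod (A # As) = A ** matrix_prod As"
  by (simp add: matrix_prod_def)

lemma matrix_prod_append: "matrix_prod (As @ Bs) = matrix_prod As ** matrix_prod Bs"
  by (induction As) (simp_all add: matrix_prod_def matrix_mul_assoc)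

text \<open>The empty product is the identity, which a multiplicatively closed set need not contain;
  this accounts for the alternative in the premise.\<close>
lemma matrix_prod_in_closed:
  assumes "mult_closed S" "set As \<subseteq> S" "As \<noteq> [] \<or> mat 1 \<in> S"
  shows "matrix_prod As \<in> S"
  using assms(2,3)
proof (induction As)
  case Nil
  then show ?case by (simp add: matrix_prod_def)
next
  case (Cons A As)
  show ?case
  proof (cases "As = []")
    case True
    then show ?thesis using Cons.prems by (simp add: matrix_prod_def)
  next
    case False
    then show ?thesis
      using Cons assms(1) by (simp add: matrix_prod_Cons mult_closed_def)
  qed
qed

lemma generated_semigroup_eq_products:
  "generated_semigroup W = {matrix_prod As | As. As \<noteq> [] \<and> set As \<subseteq> W}" (is "_ = ?P")
proof
  show "generated_semigroup W \<subseteq> ?P"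
    unfolding generated_semigroup_def
  proof (rule hull_minimal)
    show "W \<subseteq> ?P"
    proof
      fix A assume "A \<in> W"
      then show "A \<in> ?P"
        by (intro CollectI exI[of _ "[A]"]) (simp add: matrix_prod_def)
    qed
    show "mult_closed ?P"
      unfolding mult_closed_def
    proof (intro ballI)
      fix A B assume "A \<in> ?P" "B \<in> ?P"
      then obtain As Bs where
        "A = matrix_prod As" "As \<noteq> []" "set As \<subseteq> W" "B = matrix_prod Bs" "set Bs \<subseteq> W"
        by blast
      then show "A ** B \<in> ?P"
        by (intro CollectI exI[of _ "As @ Bs"]) (simp add: matrix_prod_append)
    qed
  qed
  show "?P \<subseteq> generated_semigroup W"
  proof clarify
    fix As assume "As \<noteq> []" "set As \<subseteq> W"
    then have "matrix_prod As \<in> S" if "W \<subseteq> S" "mult_closed S" for S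
      using that by (intro matrix_prod_in_closed) simp_all
    then show "matrix_prod As \<in> generated_semigroup W"
      unfolding generated_semigroup_def hull_def by blast
  qed
qed

theorem mainTheorem9:
  fixes d :: nat
  assumes n: "CARD('n::{finite,linorder}) \<ge> 2"
    and d: "1 \<le> d" "d \<le> CARD('n)^2 - CARD('n) + 1"
  shows "(\<exists>W :: (complex^'n::{finite,linorder}^'n::{finite,linorder}) set. cmat.subspace W \<and> cmat.dim W = d \<and>
            (\<forall>r. \<not> (\<forall>A. decomposes_into r W A))) \<and>
         (\<exists>W :: (complex^'n::{finite,linorder}^'n::{finite,linorder}) set. cmat.subspace W \<and> cmat.dim W = d \<and> W \<subseteq> zero_below_first) \<and>
         (\<forall>W :: (complex^'n::{finite,linorder}^'n::{finite,linorder}) set.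
            cmat.subspace W \<and> cmat.dim W = d \<and> W \<subseteq> zero_below_first \<longrightarrow>
            (\<forall>r. \<not> (\<forall>A. decomposes_into r W A)) \<and>
            generated_semigroup W = {matrix_prod As | As. As \<noteq> [] \<and> set As \<subseteq> W} \<and>
            generated_semigroup W \<noteq> UNIV) \<and>
         mult_closed (zero_below_first :: (complex^'n::{finite,linorder}^'n::{finite,linorder}) set)"
proof -
  have no_decomposition: "\<not> (\<forall>A. decomposes_into r W A)"
    if W: "W \<subseteq> zero_below_first" for r and W :: "(complex^'n::{finite,linorder}^'n::{finite,linorder}) set"
  proof
    assume all: "\<forall>A. decomposes_into r W A"
    have "A \<in> zero_below_first" for A :: "complex^'n::{finite,linorder}^'n::{finite,linorder}"
    proof -
      obtain As where "set As \<subseteq> W" "A = matrix_prod As"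
        using all unfolding decomposes_into_def by blast
      then show ?thesis
        using matrix_prod_in_closed[OF mult_closed_zero_below_first] W mat_1_in_zero_below_first
        by blast
    qed
    with zero_below_first_proper[OF n] show False by blast
  qed
  have not_generating: "generated_semigroup W \<noteq> UNIV"
    if "W \<subseteq> zero_below_first" for W :: "(complex^'n::{finite,linorder}^'n::{finite,linorder}) set"
    using hull_minimal[OF that, of mult_closed] mult_closed_zero_below_first
      zero_below_first_proper[OF n]
    unfolding generated_semigroup_def by blast
  note subspace_exists = subspace_of_dim_in_zero_below_first[OF d(2)]
  show ?thesis
  proof (intro conjI allI impI)
    show "\<exists>W :: (complex^'n::{finite,linorder}^'n::{finite,linorder}) set.
        cmat.subspace W \<and> cmat.dim W = d \<and> (\<forall>r. \<not> (\<forall>A. decomposes_into r W A))"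
      using subspace_exists no_decomposition by metis
  next
    fix W :: "(complex^'n::{finite,linorder}^'n::{finite,linorder}) set" and r
    assume "cmat.subspace W \<and> cmat.dim W = d \<and> W \<subseteq> zero_below_first"
    then have W: "W \<subseteq> zero_below_first" by simp
    show "\<not> (\<forall>A. decomposes_into r W A)" by (rule no_decomposition[OF W])
    show "generated_semigroup W \<noteq> UNIV" by (rule not_generating[OF W])
  qed (rule subspace_exists generated_semigroup_eq_products mult_closed_zero_below_first)+
qed

end
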